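(* Let $M$ be a sober MT-algebra. Then the poset $(\mathrm{SFilt}(M),\subseteq)$ of Scott-open filters of $M$ ordered by inclusion is isomorphic to the poset $(\mathrm{KS}(M),\geq)$ of compact saturated elements of $M$ ordered by the reverse of the order of $M$.
   Context: An MT-algebra is a pair $M=(B,\square)$ where $B$ is a complete boolean algebra and $\square:B\to B$ satisfies $\square 1=1$, $\square(a\wedge b)=\square a\wedge\square b$, $\square a\le a$, $\square a\le\square\square a$. Put $\diamond a=\neg\square\neg a$. An element $a$ is open if $a=\square a$ and closed if $a=\diamond a$; $\mathrm{O}(M)$ and $\mathrm{C}(M)$ are the sets of open and closed elements. An element is saturated if it is a meet of open elements, and weakly locally closed if it is the meet of a saturated element and a closed element. $M$ is a $T_0$-algebra if every element of $M$ is a join of weakly locally closed elements. $M$ is sober if it is a $T_0$-algebra and for each join-irreducible element $p$ of $\mathrm{C}(M)$ (i.e. $p\neq 0$, and $p=a\vee b$ with $a,b\in \mathrm{C}(M)$ implies $p=a$ or $p=b$) there is an atom $x$ of $M$ with $p=\diamond x$. A filter $F$ of $M$ (nonempty; the improper filter $M$ is allowed) is open if $a\in F$ implies $\square a\in F$. An open filter $F$ is Scott-open if for each directed $S\subseteq\mathrm{O}(M)$, $\bigvee S\in F$ implies $S\cap F\neq\varnothing$. An element $a\in M$ is compact if for each $S\subseteq \mathrm{O}(M)$ with $a\le\bigvee S$ there is a finite $T\subseteq S$ with $a\le\bigvee T$. $\mathrm{KS}(M)$ is the set of elements that are both compact and saturated. *)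

theory Defs
  imports Main
begin

text \<open>The complete boolean algebra is a type of sort \<open>{complete_lattice, boolean_algebra}\<close>.
  The class \<open>complete_boolean_algebra\<close> is deliberately not used: it extends
  \<open>complete_distrib_lattice\<close> and so requires complete distributivity, which would force
  the algebra to be atomic.\<close>

locale mt_algebra =
  fixes box :: "'a :: {complete_lattice, boolean_algebra} \<Rightarrow> 'a"
  assumes box_top: "box top = top"
    and box_inf: "box (inf a b) = inf (box a) (box b)"
    and box_le: "box a \<le> a"
    and box_le_box_box: "box a \<le> box (box a)"

definition diamond :: "('a \<Rightarrow> 'a) \<Rightarrow> 'a :: {complete_lattice, boolean_algebra} \<Rightarrow> 'a"
  where "diamond box a = - box (- a)"

definition open_elements :: "('a \<Rightarrow> 'a) \<Rightarrow> 'a :: {complete_lattice, boolean_algebra} set"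
  where "open_elements box = {a. a = box a}"

definition closed_elements :: "('a \<Rightarrow> 'a) \<Rightarrow> 'a :: {complete_lattice, boolean_algebra} set"
  where "closed_elements box = {a. a = diamond box a}"

definition saturated :: "('a \<Rightarrow> 'a) \<Rightarrow> 'a :: {complete_lattice, boolean_algebra} \<Rightarrow> bool"
  where "saturated box a \<longleftrightarrow> (\<exists>S \<subseteq> open_elements box. a = Inf S)"

definition weakly_locally_closed ::
    "('a \<Rightarrow> 'a) \<Rightarrow> 'a :: {complete_lattice, boolean_algebra} \<Rightarrow> bool"
  where "weakly_locally_closed box a \<longleftrightarrow>
    (\<exists>s c. saturated box s \<and> c \<in> closed_elements box \<and> a = inf s c)"

definition T0_algebra :: "('a :: {complete_lattice, boolean_algebra} \<Rightarrow> 'a) \<Rightarrow> bool"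
  where "T0_algebra box \<longleftrightarrow>
    mt_algebra box \<and> (\<forall>a. \<exists>W. (\<forall>w\<in>W. weakly_locally_closed box w) \<and> a = Sup W)"

definition atom :: "'a :: {complete_lattice, boolean_algebra} \<Rightarrow> bool"
  where "atom x \<longleftrightarrow> x \<noteq> bot \<and> (\<forall>y. y \<le> x \<longrightarrow> y = bot \<or> y = x)"

definition join_irreducible_closed ::
    "('a \<Rightarrow> 'a) \<Rightarrow> 'a :: {complete_lattice, boolean_algebra} \<Rightarrow> bool"
  where "join_irreducible_closed box p \<longleftrightarrow>
    p \<in> closed_elements box \<and> p \<noteq> bot \<and>
    (\<forall>a \<in> closed_elements box. \<forall>b \<in> closed_elements box. p = sup a b \<longrightarrow> p = a \<or> p = b)"

definition sober :: "('a :: {complete_lattice, boolean_algebra} \<Rightarrow> 'a) \<Rightarrow> bool"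
  where "sober box \<longleftrightarrow>
    T0_algebra box \<and> (\<forall>p. join_irreducible_closed box p \<longrightarrow> (\<exists>x. atom x \<and> p = diamond box x))"

text \<open>Possibly improper filters, as sets of elements.\<close>

definition lattice_filter :: "'a :: {complete_lattice, boolean_algebra} set \<Rightarrow> bool"
  where "lattice_filter F \<longleftrightarrow>
    F \<noteq> {} \<and> (\<forall>a\<in>F. \<forall>b. a \<le> b \<longrightarrow> b \<in> F) \<and> (\<forall>a\<in>F. \<forall>b\<in>F. inf a b \<in> F)"

definition open_filter :: "('a \<Rightarrow> 'a) \<Rightarrow> 'a :: {complete_lattice, boolean_algebra} set \<Rightarrow> bool"
  where "open_filter box F \<longleftrightarrow> lattice_filter F \<and> (\<forall>a\<in>F. box a \<in> F)"

text \<open>Directed sets are nonempty; otherwise the improper filter would not be Scott-open, as it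
  contains the join \<open>bot\<close> of the empty set.\<close>

definition directed :: "'a :: order set \<Rightarrow> bool"
  where "directed S \<longleftrightarrow> S \<noteq> {} \<and> (\<forall>a\<in>S. \<forall>b\<in>S. \<exists>c\<in>S. a \<le> c \<and> b \<le> c)"

definition Scott_open_filter ::
    "('a \<Rightarrow> 'a) \<Rightarrow> 'a :: {complete_lattice, boolean_algebra} set \<Rightarrow> bool"
  where "Scott_open_filter box F \<longleftrightarrow>
    open_filter box F \<and>
    (\<forall>S \<subseteq> open_elements box. directed S \<longrightarrow> Sup S \<in> F \<longrightarrow> S \<inter> F \<noteq> {})"

definition SFilt :: "('a \<Rightarrow> 'a) \<Rightarrow> 'a :: {complete_lattice, boolean_algebra} set set"
  where "SFilt box = {F. Scott_open_filter box F}"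

definition compact_element :: "('a \<Rightarrow> 'a) \<Rightarrow> 'a :: {complete_lattice, boolean_algebra} \<Rightarrow> bool"
  where "compact_element box a \<longleftrightarrow>
    (\<forall>S \<subseteq> open_elements box. a \<le> Sup S \<longrightarrow> (\<exists>T \<subseteq> S. finite T \<and> a \<le> Sup T))"

definition KS :: "('a \<Rightarrow> 'a) \<Rightarrow> 'a :: {complete_lattice, boolean_algebra} set"
  where "KS box = {a. compact_element box a \<and> saturated box a}"

definition poset_isomorphic ::
    "'a set \<Rightarrow> ('a \<Rightarrow> 'a \<Rightarrow> bool) \<Rightarrow> 'b set \<Rightarrow> ('b \<Rightarrow> 'b \<Rightarrow> bool) \<Rightarrow> bool"
  where "poset_isomorphic A leA B leB \<longleftrightarrow>
    (\<exists>f. bij_betw f A B \<and> (\<forall>x\<in>A. \<forall>y\<in>A. leA x y \<longleftrightarrow> leB (f x) (f y)))"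

end

theory Submission
  imports Defs
begin

text \<open>A Scott-open filter \<open>F\<close> is sent to its meet, with inverse \<open>k \<mapsto> {a. k \<le> \<box>a}\<close>. Everything rests
  on a Hofmann--Mislove argument: an open \<open>u \<ge> \<And>F\<close> lies in \<open>F\<close>. Otherwise \<open>u\<close> is below a
  maximal open \<open>m \<notin> F\<close>, whose complement is join-irreducible, hence the closure of an atom \<open>x\<close>.
  This atom lies below every member of \<open>F\<close>, so \<open>x \<le> \<And>F \<le> m\<close>, contradicting \<open>x \<le> \<diamond>x = \<not>m\<close>.\<close>

context mt_algebra
begin

lemma box_mono: "a \<le> b \<Longrightarrow> box a \<le> box b"
  by (metis box_inf inf.absorb_iff2)

lemma open_elements_iff_le: "a \<in> open_elements box \<longleftrightarrow> a \<le> box a"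
  unfolding open_elements_def using box_le by (auto intro: antisym)

lemma box_in_open_elements: "box a \<in> open_elements box"
  by (simp add: open_elements_iff_le box_le_box_box)

lemma closed_elements_iff_compl: "c \<in> closed_elements box \<longleftrightarrow> - c \<in> open_elements box"
proof -
  have "c = - box (- c) \<longleftrightarrow> - c = box (- c)"
    using compl_eq_compl_iff[of c "- box (- c)"] by simp
  then show ?thesis by (simp add: closed_elements_def open_elements_def diamond_def)
qed

lemma Sup_in_open_elements:
  assumes "S \<subseteq> open_elements box"
  shows "Sup S \<in> open_elements box"
  unfolding open_elements_iff_le
proof (rule Sup_least)
  fix a assume "a \<in> S"
  with assms have "a \<le> box a" by (auto simp: open_elements_iff_le)
  also have "\<dots> \<le> box (Sup S)" using \<open>a \<in> S\<close> by (intro box_mono Sup_upper)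
  finally show "a \<le> box (Sup S)" .
qed

lemma le_diamond: "a \<le> diamond box a"
  unfolding diamond_def using box_le[of "- a"] compl_le_swap1 by blast

end

lemma atom_le_or_le_compl:
  assumes "atom x"
  shows "x \<le> a \<or> x \<le> - a"
  using assms unfolding atom_def
  by (metis inf.cobounded1 inf.absorb_iff1 inf_shunt)

lemma directed_finite_upper_bound:
  assumes "directed S" "finite T" "T \<subseteq> S"
  shows "\<exists>c\<in>S. \<forall>a\<in>T. a \<le> c"
  using assms(2,3)
proof (induction rule: finite_induct)
  \<comment> \<open>Nonemptiness of directed sets settles this case, which later covers an empty
    finite subcover.\<close>
  case empty
  then show ?case using assms(1) by (auto simp: directed_def)
next
  case (insert a T)
  then obtain c where "c \<in> S" "\<forall>t\<in>T. t \<le> c" by auto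
  moreover obtain d where "d \<in> S" "a \<le> d" "c \<le> d"
    using assms(1) insert.prems \<open>c \<in> S\<close> unfolding directed_def by blast
  ultimately show ?case by (metis insert_iff order_trans)
qed

context
  fixes box :: "'a :: {complete_lattice, boolean_algebra} \<Rightarrow> 'a" and F
  assumes F: "Scott_open_filter box F"
begin

lemma Scott_open_filter_upward: "a \<in> F \<Longrightarrow> a \<le> b \<Longrightarrow> b \<in> F"
  and Scott_open_filter_inf: "a \<in> F \<Longrightarrow> b \<in> F \<Longrightarrow> inf a b \<in> F"
  and Scott_open_filter_box: "a \<in> F \<Longrightarrow> box a \<in> F"
  using F unfolding Scott_open_filter_def open_filter_def lattice_filter_def by blast+

lemma Scott_open_filter_directed:
  "S \<subseteq> open_elements box \<Longrightarrow> directed S \<Longrightarrow> Sup S \<in> F \<Longrightarrow> \<exists>s\<in>S. s \<in> F"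
  using F unfolding Scott_open_filter_def by (metis disjoint_iff)

lemma Scott_open_filter_top: "top \<in> F"
  using F unfolding Scott_open_filter_def open_filter_def lattice_filter_def
  by (metis ex_in_conv top_greatest)

text \<open>Zorn's lemma applies because a nonempty chain is directed: if the join of a chain of
  open elements outside \<open>F\<close> were in \<open>F\<close>, Scott-openness would put a member
  of the chain in \<open>F\<close>.\<close>

lemma ex_maximal_open_notin:
  assumes "mt_algebra box" "u \<in> open_elements box" "u \<notin> F"
  shows "\<exists>m\<in>open_elements box. m \<notin> F \<and> u \<le> m \<and>
    (\<forall>v\<in>open_elements box. m \<le> v \<longrightarrow> v \<notin> F \<longrightarrow> v = m)"
proof -
  interpret mt_algebra box by fact
  define A where "A = {v \<in> open_elements box. v \<notin> F \<and> u \<le> v}"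
  have "\<exists>m\<in>A. \<forall>a\<in>A. m \<le> a \<longrightarrow> a = m"
  proof (rule predicate_Zorn)
    show "partial_order_on A (relation_of (\<le>) A)"
      by (rule partial_order_on_relation_ofI) auto
    fix C assume C: "C \<in> Chains (relation_of (\<le>) A)"
    then have chain: "\<And>a b. a \<in> C \<Longrightarrow> b \<in> C \<Longrightarrow> (a \<le> b \<or> b \<le> a) \<and> a \<in> A"
      unfolding Chains_def relation_of_def by auto
    show "\<exists>v\<in>A. \<forall>a\<in>C. a \<le> v"
    proof (cases "C = {}")
      \<comment> \<open>The empty chain is not directed, so it is bounded by \<open>u\<close>
        itself.\<close>
      case True
      then show ?thesis using assms by (auto simp: A_def)
    next
      case False
      then have "directed C" using chain unfolding directed_def by metis
      moreover have sub: "C \<subseteq> open_elements box" "C \<inter> F = {}"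
        using chain unfolding A_def by blast+
      ultimately have "Sup C \<notin> F" using Scott_open_filter_directed by blast
      moreover have "u \<le> Sup C"
        using False chain unfolding A_def by (metis (lifting) Sup_upper2 ex_in_conv mem_Collect_eq)
      ultimately have "Sup C \<in> A" using Sup_in_open_elements[OF sub(1)] by (simp add: A_def)
      then show ?thesis by (auto intro: Sup_upper)
    qed
  qed
  then show ?thesis unfolding A_def by (auto intro: order_trans)
qed

text \<open>Splitting \<open>- m\<close> as a join of closed elements writes \<open>m\<close> as a
  meet of two open elements. As \<open>F\<close> is closed under binary meets, one of them is
  outside \<open>F\<close>, and maximality makes it equal to \<open>m\<close>.\<close>

lemma compl_maximal_open_join_irreducible:
  assumes "mt_algebra box" "m \<in> open_elements box" "m \<notin> F"
    and max: "\<And>v. v \<in> open_elements box \<Longrightarrow> m \<le> v \<Longrightarrow> v \<notin> F \<Longrightarrow> v = m"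
  shows "join_irreducible_closed box (- m)"
  unfolding join_irreducible_closed_def
proof (intro conjI ballI impI)
  interpret mt_algebra box by fact
  show "- m \<in> closed_elements box" using assms(2) by (simp add: closed_elements_iff_compl)
  show "- m \<noteq> bot" using assms(3) Scott_open_filter_top
    by (metis compl_bot_eq double_compl)
  fix a b
  assume ab: "a \<in> closed_elements box" "b \<in> closed_elements box" "- m = sup a b"
  then have m: "m = inf (- a) (- b)" by (metis compl_sup double_compl)
  then have "- a \<notin> F \<or> - b \<notin> F" using Scott_open_filter_inf assms(3) by blast
  then have "- a = m \<or> - b = m"
    using max ab(1,2) m by (metis closed_elements_iff_compl inf.cobounded1 inf.cobounded2)
  then show "- m = a \<or> - m = b" by auto
qed

lemma open_ge_Inf_in_Scott_open_filter:
  assumes "sober box" "u \<in> open_elements box" "Inf F \<le> u"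
  shows "u \<in> F"
proof (rule ccontr)
  assume "u \<notin> F"
  have mt: "mt_algebra box" using assms(1) by (simp add: sober_def T0_algebra_def)
  interpret mt_algebra box by (rule mt)
  obtain m where m: "m \<in> open_elements box" "m \<notin> F" "u \<le> m"
    and max: "\<And>v. v \<in> open_elements box \<Longrightarrow> m \<le> v \<Longrightarrow> v \<notin> F \<Longrightarrow> v = m"
    using ex_maximal_open_notin[OF mt assms(2) \<open>u \<notin> F\<close>] by blast
  obtain x where x: "atom x" "- m = diamond box x"
    using compl_maximal_open_join_irreducible[OF mt m(1,2) max] assms(1)
    unfolding sober_def by blast
  have "x \<le> a" if "a \<in> F" for a
  proof (rule ccontr)
    assume "\<not> x \<le> a"
    then have "a \<le> - x" using atom_le_or_le_compl[OF x(1)] compl_le_swap1 by blast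
    \<comment> \<open>Taking interiors turns \<open>a \<le> - x\<close> into
      \<open>box a \<le> box (- x) = m\<close>; openness of \<open>F\<close> then forces
      \<open>m\<close> into \<open>F\<close>.\<close>
    then have "box a \<le> m" using box_mono x(2) by (metis compl_eq_compl_iff diamond_def)
    then show False using Scott_open_filter_box[OF that] Scott_open_filter_upward m(2) by blast
  qed
  then have "x \<le> m" using assms(3) m(3) by (meson Inf_greatest order_trans)
  moreover have "x \<le> - m" using x(2) le_diamond by simp
  ultimately show False using x(1) unfolding atom_def
    by (metis inf_compl_bot le_inf_iff bot_unique)
qed

text \<open>Closure of \<open>F\<close> under \<open>box\<close> puts the interior of each member
  back into \<open>F\<close>, so the meet can be taken over open members alone.\<close>

lemma Inf_Scott_open_filter_saturated:
  assumes "mt_algebra box"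
  shows "saturated box (Inf F)"
proof -
  interpret mt_algebra box by fact
  have "Inf F = Inf (box ` F)"
  proof (rule antisym)
    show "Inf F \<le> Inf (box ` F)"
      by (rule Inf_superset_mono) (auto intro: Scott_open_filter_box)
    show "Inf (box ` F) \<le> Inf F"
      by (rule Inf_greatest) (auto intro: INF_lower2 box_le)
  qed
  then show ?thesis unfolding saturated_def using box_in_open_elements by blast
qed

text \<open>The join of an open cover of \<open>Inf F\<close> is an open element above
  \<open>Inf F\<close>, hence a member of \<open>F\<close>. Scott-openness, applied to the finite
  joins of the cover, yields one in \<open>F\<close>, and that one lies above
  \<open>Inf F\<close>.\<close>

lemma Inf_Scott_open_filter_compact:
  assumes "sober box"
  shows "compact_element box (Inf F)"
  unfolding compact_element_def
proof (intro allI impI)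
  interpret mt_algebra box using assms by (simp add: sober_def T0_algebra_def)
  fix S assume S: "S \<subseteq> open_elements box" "Inf F \<le> Sup S"
  \<comment> \<open>Scott-openness speaks of directed families only, so \<open>S\<close> is replaced
    by its finite joins. The choice \<open>T = {}\<close> puts \<open>bot\<close> into
    \<open>D\<close> and keeps \<open>D\<close> nonempty when \<open>S\<close> is empty.\<close>
  define D where "D = Sup ` {T. T \<subseteq> S \<and> finite T}"
  have "directed D"
    unfolding directed_def
  proof (intro conjI ballI)
    show "D \<noteq> {}" unfolding D_def by blast
    fix a b assume "a \<in> D" "b \<in> D"
    then obtain T U where "T \<subseteq> S" "finite T" "a = Sup T" "U \<subseteq> S" "finite U" "b = Sup U"
      unfolding D_def by blast
    then show "\<exists>c\<in>D. a \<le> c \<and> b \<le> c"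
      unfolding D_def by (intro bexI[of _ "Sup (T \<union> U)"]) (auto intro: Sup_subset_mono)
  qed
  moreover have "D \<subseteq> open_elements box"
    unfolding D_def using S(1) Sup_in_open_elements by blast
  moreover have "Sup S \<le> Sup D"
  proof (rule Sup_least)
    fix s assume "s \<in> S"
    then have "Sup {s} \<in> D" unfolding D_def by blast
    then show "s \<le> Sup D" by (simp add: Sup_upper)
  qed
  then have "Sup D \<in> F"
    using open_ge_Inf_in_Scott_open_filter[OF assms Sup_in_open_elements[OF S(1)] S(2)]
      Scott_open_filter_upward by blast
  ultimately obtain d where "d \<in> D" "d \<in> F" using Scott_open_filter_directed by blast
  then show "\<exists>T\<subseteq>S. finite T \<and> Inf F \<le> Sup T"
    unfolding D_def by (auto intro: Inf_lower)
qed

end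

text \<open>\<open>{a. k \<le> box a}\<close> plays the role of the neighbourhood filter of
  \<open>k\<close>. Compactness yields Scott-openness: finitely many members of a directed cover
  suffice, and a single member bounds them. For \<open>k = bot\<close>, which is compact and
  saturated, this is the improper filter.\<close>

lemma Scott_open_filter_of_compact:
  assumes "mt_algebra box" "compact_element box k"
  shows "Scott_open_filter box {a. k \<le> box a}"
proof -
  interpret mt_algebra box by fact
  have "{a. k \<le> box a} \<noteq> {}" using box_top by (metis empty_iff mem_Collect_eq top_greatest)
  then have "open_filter box {a. k \<le> box a}"
    unfolding open_filter_def lattice_filter_def
    by (auto simp: box_inf intro: order_trans box_mono box_le_box_box)
  moreover have "S \<inter> {a. k \<le> box a} \<noteq> {}"
    if S: "S \<subseteq> open_elements box" "directed S" "Sup S \<in> {a. k \<le> box a}" for S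
  proof -
    have "k \<le> Sup S" using S(3) box_le order_trans by blast
    then obtain T where T: "T \<subseteq> S" "finite T" "k \<le> Sup T"
      using assms(2) S(1) unfolding compact_element_def by blast
    obtain c where c: "c \<in> S" "\<forall>a\<in>T. a \<le> c"
      using directed_finite_upper_bound[OF S(2) T(2,1)] by blast
    have "k \<le> c" using T(3) c(2) by (meson Sup_least order_trans)
    moreover have "c \<le> box c" using c(1) S(1) open_elements_iff_le by blast
    ultimately show ?thesis using c(1) order_trans by blast
  qed
  ultimately show ?thesis unfolding Scott_open_filter_def by blast
qed

text \<open>Each open element in a representation of \<open>k\<close> as a meet equals its own
  interior and so belongs to this filter, which pushes the meet of the filter down to
  \<open>k\<close>.\<close>

lemma Inf_open_neighbourhoods_saturated:
  assumes "mt_algebra box" "saturated box k"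
  shows "Inf {a. k \<le> box a} = k"
proof (rule antisym)
  interpret mt_algebra box by fact
  show "k \<le> Inf {a. k \<le> box a}" by (auto intro!: Inf_greatest intro: order_trans box_le)
  obtain S where S: "S \<subseteq> open_elements box" "k = Inf S"
    using assms(2) unfolding saturated_def by blast
  have "k \<le> box a" if "a \<in> S" for a
  proof -
    have "k \<le> a" using S(2) that by (simp add: Inf_lower)
    also have "a \<le> box a" using S(1) that open_elements_iff_le by auto
    finally show ?thesis .
  qed
  then have "S \<subseteq> {a. k \<le> box a}" by blast
  then show "Inf {a. k \<le> box a} \<le> k" using S(2) by (simp add: Inf_superset_mono)
qed

text \<open>An open element belongs to a Scott-open filter exactly when it lies above the meet of
  the filter. Hence for \<open>a \<in> F\<close> the open element \<open>box a\<close>, being above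
  \<open>Inf F\<close> and so above \<open>Inf G\<close>, lies in \<open>G\<close>, and
  \<open>a\<close> follows by upward closure.\<close>

lemma Scott_open_filter_subset_iff:
  assumes "sober box" "Scott_open_filter box F" "Scott_open_filter box G"
  shows "F \<subseteq> G \<longleftrightarrow> Inf G \<le> Inf F"
proof
  show "F \<subseteq> G \<Longrightarrow> Inf G \<le> Inf F" by (rule Inf_superset_mono)
next
  interpret mt_algebra box using assms(1) by (simp add: sober_def T0_algebra_def)
  assume le: "Inf G \<le> Inf F"
  show "F \<subseteq> G"
  proof
    fix a assume "a \<in> F"
    then have "Inf G \<le> box a"
      using le Scott_open_filter_box[OF assms(2)] by (meson Inf_lower order_trans)
    then have "box a \<in> G"
      using open_ge_Inf_in_Scott_open_filter[OF assms(3,1) box_in_open_elements] by blast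
    then show "a \<in> G" using Scott_open_filter_upward[OF assms(3)] box_le by blast
  qed
qed

theorem theorem3p7:
  fixes box :: "'a :: {complete_lattice, boolean_algebra} \<Rightarrow> 'a"
  assumes "mt_algebra box" and "sober box"
  shows "poset_isomorphic (SFilt box) (\<subseteq>) (KS box) (\<ge>)"
  unfolding poset_isomorphic_def
proof (intro exI conjI ballI)
  have iff: "F \<subseteq> G \<longleftrightarrow> Inf F \<ge> Inf G" if "F \<in> SFilt box" "G \<in> SFilt box" for F G
    using Scott_open_filter_subset_iff[OF assms(2)] that by (simp add: SFilt_def)
  then show "F \<subseteq> G \<longleftrightarrow> Inf F \<ge> Inf G" if "F \<in> SFilt box" "G \<in> SFilt box" for F G
    using that .
  show "bij_betw Inf (SFilt box) (KS box)"
    unfolding bij_betw_def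
  proof
    \<comment> \<open>Equal meets give both inclusions by order reflection.\<close>
    show "inj_on Inf (SFilt box)" using iff by (intro inj_onI) (metis order_refl subset_antisym)
    show "Inf ` SFilt box = KS box"
    proof
      show "Inf ` SFilt box \<subseteq> KS box"
        using Inf_Scott_open_filter_compact[OF _ assms(2)]
          Inf_Scott_open_filter_saturated[OF _ assms(1)]
        by (auto simp: SFilt_def KS_def)
      show "KS box \<subseteq> Inf ` SFilt box"
        using Scott_open_filter_of_compact[OF assms(1)]
          Inf_open_neighbourhoods_saturated[OF assms(1)]
        by (force simp: SFilt_def KS_def image_iff)
    qed
  qed
qed

end
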